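(* $\mathrm{BMTL}[F,P]\not\subseteq\mathrm{MITL}[U,S]$: there is a BMTL$[F,P]$ formula $\phi$ such that no MITL$[U,S]$ formula $\psi$ satisfies $\mathcal{L}(\psi)=\mathcal{L}(\phi)$.
   Context: Fix a finite alphabet $\Sigma$. A timed word is $\rho=(\sigma_1,\tau_1)\cdots(\sigma_n,\tau_n)$, $n\ge1$, $\sigma_i\in\Sigma$, $\tau_i\in\mathbb{R}_{\ge0}$, $\tau_1=0$, $\tau_i\le\tau_{i+1}$. An interval is a convex subset of $\mathbb{R}_{\ge0}$ with endpoints non-negative integers or $\infty$ (finite ends open or closed); it is singular if of the form $[c,c]$, bounded if it does not extend to $\infty$. MTL$[U,S]$ formulas: $\phi::=a\mid\phi\wedge\phi\mid\neg\phi\mid\phi U_I\phi\mid\phi S_I\phi$ ($a\in\Sigma$, $I$ an interval), with strict semantics: $\rho,i\models\phi_1U_I\phi_2$ iff $\exists j>i$: $\rho,j\models\phi_2$, $\tau_j-\tau_i\in I$, $\forall i<k<j$: $\rho,k\models\phi_1$; $\rho,i\models\phi_1S_I\phi_2$ iff $\exists j<i$: $\rho,j\models\phi_2$, $\tau_i-\tau_j\in I$, $\forall j<k<i$: $\rho,k\models\phi_1$; $\rho,i\models a$ iff $\sigma_i=a$; Booleans as usual. $F_I\phi:=\top U_I\phi$, $P_I\phi:=\top S_I\phi$. $\mathcal{L}(\phi)=\{\rho:\rho,1\models\phi\}$. MITL$[U,S]$ allows only non-singular intervals, BMTL$[U,S]$ only bounded intervals; BMTL$[F,P]$ is the fragment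 of BMTL$[U,S]$ using only the modalities $F_I,P_I$. *)

theory Defs
  imports Complex_Main
begin

text \<open>Degenerate endpoints (such as \<open>(c,c)\<close>) give the empty interval, which is neither singular
  nor unbounded; a modality indexed by it is unsatisfiable.\<close>

typedef interval =
  "{I :: real set. \<exists>(l::nat) (u::nat).
      I = {real l..real u} \<or> I = {real l..<real u} \<or> I = {real l<..real u} \<or>
      I = {real l<..<real u} \<or> I = {real l..} \<or> I = {real l<..}}"
  morphisms set_of_interval Interval
  by blast

definition singular :: "interval \<Rightarrow> bool" where
  "singular I \<longleftrightarrow> (\<exists>c::nat. set_of_interval I = {real c..real c})"

definition bounded_interval :: "interval \<Rightarrow> bool" where
  "bounded_interval I \<longleftrightarrow> bdd_above (set_of_interval I)"

definition timed_word :: "('a \<times> real) list \<Rightarrow> bool" where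
  "timed_word \<rho> \<longleftrightarrow> \<rho> \<noteq> [] \<and> snd (hd \<rho>) = 0 \<and> (\<forall>\<tau> \<in> set (map snd \<rho>). 0 \<le> \<tau>) \<and> sorted (map snd \<rho>)"

datatype 'a mtl =
    Letter 'a
  | Conj "'a mtl" "'a mtl"
  | Neg "'a mtl"
  | Until "'a mtl" interval "'a mtl"
  | Since "'a mtl" interval "'a mtl"

text \<open>Positions are list indices, so the first position of a word is \<open>0\<close>.\<close>

primrec sat :: "('a \<times> real) list \<Rightarrow> nat \<Rightarrow> 'a mtl \<Rightarrow> bool" where
  "sat \<rho> i (Letter a) \<longleftrightarrow> fst (\<rho> ! i) = a"
| "sat \<rho> i (Conj \<phi> \<psi>) \<longleftrightarrow> sat \<rho> i \<phi> \<and> sat \<rho> i \<psi>"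
| "sat \<rho> i (Neg \<phi>) \<longleftrightarrow> \<not> sat \<rho> i \<phi>"
| "sat \<rho> i (Until \<phi> I \<psi>) \<longleftrightarrow>
     (\<exists>j. i < j \<and> j < length \<rho> \<and> sat \<rho> j \<psi> \<and> snd (\<rho> ! j) - snd (\<rho> ! i) \<in> set_of_interval I \<and>
          (\<forall>k. i < k \<and> k < j \<longrightarrow> sat \<rho> k \<phi>))"
| "sat \<rho> i (Since \<phi> I \<psi>) \<longleftrightarrow>
     (\<exists>j. j < i \<and> sat \<rho> j \<psi> \<and> snd (\<rho> ! i) - snd (\<rho> ! j) \<in> set_of_interval I \<and>
          (\<forall>k. j < k \<and> k < i \<longrightarrow> sat \<rho> k \<phi>))"

definition lang :: "'a mtl \<Rightarrow> ('a \<times> real) list set" where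
  "lang \<phi> = {\<rho>. timed_word \<rho> \<and> sat \<rho> 0 \<phi>}"

text \<open>The grammar has no constant for truth; it is the tautology \<open>\<not> (a \<and> \<not> a)\<close> for an
  arbitrarily chosen letter \<open>a\<close>.\<close>

definition Top :: "'a mtl" where
  "Top = (let a = (SOME a. True) in Neg (Conj (Letter a) (Neg (Letter a))))"

definition Fut :: "interval \<Rightarrow> 'a mtl \<Rightarrow> 'a mtl" where
  "Fut I \<phi> = Until Top I \<phi>"

definition Past :: "interval \<Rightarrow> 'a mtl \<Rightarrow> 'a mtl" where
  "Past I \<phi> = Since Top I \<phi>"

primrec intervals :: "'a mtl \<Rightarrow> interval set" where
  "intervals (Letter a) = {}"
| "intervals (Conj \<phi> \<psi>) = intervals \<phi> \<union> intervals \<psi>"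
| "intervals (Neg \<phi>) = intervals \<phi>"
| "intervals (Until \<phi> I \<psi>) = insert I (intervals \<phi> \<union> intervals \<psi>)"
| "intervals (Since \<phi> I \<psi>) = insert I (intervals \<phi> \<union> intervals \<psi>)"

definition MITL_US :: "'a mtl set" where
  "MITL_US = {\<phi>. \<forall>I \<in> intervals \<phi>. \<not> singular I}"

definition BMTL_US :: "'a mtl set" where
  "BMTL_US = {\<phi>. \<forall>I \<in> intervals \<phi>. bounded_interval I}"

inductive_set MTL_FP :: "'a mtl set" where
  "Letter a \<in> MTL_FP"
| "\<lbrakk>\<phi> \<in> MTL_FP; \<psi> \<in> MTL_FP\<rbrakk> \<Longrightarrow> Conj \<phi> \<psi> \<in> MTL_FP"
| "\<phi> \<in> MTL_FP \<Longrightarrow> Neg \<phi> \<in> MTL_FP"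
| "\<phi> \<in> MTL_FP \<Longrightarrow> Fut I \<phi> \<in> MTL_FP"
| "\<phi> \<in> MTL_FP \<Longrightarrow> Past I \<phi> \<in> MTL_FP"

definition BMTL_FP :: "'a mtl set" where
  "BMTL_FP = BMTL_US \<inter> MTL_FP"

end

theory Submission imports Defs begin

text \<open>The formula \<open>F (F \<top>)\<close>, with interval \<open>(0,1)\<close> on the outer and \<open>[1,1]\<close> on the inner modality,
  asks for an event strictly between times 0 and 1 that has another event exactly one
  time unit later. Consider words over one letter with events \<open>0 < x\<^sub>1 < \<dots> < x\<^sub>n < 1 < y\<^sub>1 < \<dots> < y\<^sub>n < 2\<close>
  and a last event at time 2, where \<open>y\<^sub>j - x\<^sub>i\<close> is below 1 for \<open>j < i\<close> and above 1 for \<open>j \<ge> i\<close>, except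
  that nothing is required of \<open>y\<^sub>m - x\<^sub>m\<close> for the middle index \<open>m\<close>. A non-singular interval containing 1
  contains \<open>(0,1)\<close> or \<open>(1,2)\<close>, so in an Ehrenfeucht-Fraisse game a move from \<open>x\<^sub>m\<close> to \<open>y\<^sub>m\<close> can be
  answered by a move to a neighbour of \<open>y\<^sub>m\<close>, which is indistinguishable from \<open>y\<^sub>m\<close> as long as it
  is far from both ends of its block. Hence an MITL formula of depth below \<open>m\<close> does not distinguish
  two such words, whereas the formula above holds iff \<open>y\<^sub>m - x\<^sub>m = 1\<close>.\<close>

section \<open>Intervals with integer endpoints\<close>

lemma set_of_interval_cases:
  obtains l u :: nat where
    "set_of_interval I = {real l..real u} \<or> set_of_interval I = {real l..<real u} \<or>
     set_of_interval I = {real l<..real u} \<or> set_of_interval I = {real l<..<real u} \<or>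
     set_of_interval I = {real l..} \<or> set_of_interval I = {real l<..}"
  using set_of_interval[of I] by blast

text \<open>Endpoints are integers, so none lies strictly between \<open>n\<close> and
  \<open>n + 1\<close>, and no interval can cut this open cell.\<close>

lemma interval_contains_unit_cell:
  assumes "d \<in> set_of_interval I" "real n < d" "d < real n + 1" "real n < e" "e < real n + 1"
  shows "e \<in> set_of_interval I"
proof -
  have lower: "real l < e" if "real l \<le> d" for l
  proof -
    have "real l < real (Suc n)" using that assms by simp
    then have "real l \<le> real n" by (simp only: of_nat_less_iff of_nat_le_iff less_Suc_eq_le)
    then show ?thesis using assms by simp
  qed
  have upper: "e < real u" if "d \<le> real u" for u
  proof -
    have "n < u" using that assms by simp
    then have "real n + 1 \<le> real u" by simp
    then show ?thesis using assms by simp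
  qed
  obtain l u :: nat where
    "set_of_interval I = {real l..real u} \<or> set_of_interval I = {real l..<real u} \<or>
     set_of_interval I = {real l<..real u} \<or> set_of_interval I = {real l<..<real u} \<or>
     set_of_interval I = {real l..} \<or> set_of_interval I = {real l<..}"
    by (rule set_of_interval_cases)
  then show ?thesis
    using assms(1) lower[of l] upper[of u] by (elim disjE; simp add: less_imp_le)
qed

text \<open>The left endpoint is 0 or 1. If it is 0, the interval fills the cell below 1. If it is
  1, the right end cannot also be 1, since that would be the singular \<open>[1,1]\<close>, so it is
  at least 2 or infinite.\<close>

lemma nonsingular_interval_around_one:
  assumes "1 \<in> set_of_interval I" "\<not> singular I"
  shows "{0<..<1} \<subseteq> set_of_interval I \<or> {1<..<2} \<subseteq> set_of_interval I"
proof -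
  obtain l u :: nat where lu:
    "set_of_interval I = {real l..real u} \<or> set_of_interval I = {real l..<real u} \<or>
     set_of_interval I = {real l<..real u} \<or> set_of_interval I = {real l<..<real u} \<or>
     set_of_interval I = {real l..} \<or> set_of_interval I = {real l<..}"
    by (rule set_of_interval_cases)
  note iffs = atLeastAtMost_iff atLeastLessThan_iff greaterThanAtMost_iff greaterThanLessThan_iff
    atLeast_iff greaterThan_iff
  show ?thesis
  proof (cases "l = 0")
    case True
    have "x \<in> set_of_interval I" if "0 < x" "x < 1" for x
      using lu assms(1) that True by (elim disjE; simp only: iffs; linarith)
    then show ?thesis by auto
  next
    case False
    have "x \<in> set_of_interval I" if x: "1 < x" "x < 2" for x
    proof -
      have "l \<le> 1" using lu assms(1) by (elim disjE; simp only: iffs; linarith)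
      then have l: "l = 1" using False by simp
      have l': "real l = 1" using l by simp
      have u: "\<not> 1 < real u \<or> 2 \<le> real u" by (cases "u \<le> 1") auto
      show ?thesis
      proof (cases "set_of_interval I = {real l..real u}")
        case True
        then have "u \<noteq> 1" using assms(2) unfolding singular_def l by blast
        then show ?thesis using assms(1) x l unfolding True iffs by linarith
      next
        case False
        show ?thesis
          using mp[OF iffD1[OF disj_imp lu] False] assms(1) x l' u
          by (elim disjE; simp only: iffs; linarith)
      qed
    qed
    then show ?thesis by auto
  qed
qed

text \<open>A sufficient condition for two distances to lie in the same intervals. Equality is
  needed for the distance 2 between the first and the last event.\<close>

definition same_cell :: "real \<Rightarrow> real \<Rightarrow> bool" where
  "same_cell d e \<longleftrightarrow> d = e \<or> 0 < d \<and> d < 1 \<and> 0 < e \<and> e < 1 \<or> 1 < d \<and> d < 2 \<and> 1 < e \<and> e < 2"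

lemma same_cell_interval:
  assumes "same_cell d e" "d \<in> set_of_interval I"
  shows "e \<in> set_of_interval I"
  using assms interval_contains_unit_cell[of d I 0 e] interval_contains_unit_cell[of d I 1 e]
  unfolding same_cell_def by auto

lemma nonsingular_interval_contains_cell:
  assumes "d \<in> set_of_interval I" "\<not> singular I" "0 < d" "d < 2"
  shows "{0<..<1} \<subseteq> set_of_interval I \<or> {1<..<2} \<subseteq> set_of_interval I"
proof (cases "d = 1")
  case True
  then show ?thesis using nonsingular_interval_around_one assms by blast
next
  case False
  then consider "d < 1" | "1 < d" by linarith
  then show ?thesis
  proof cases
    case 1
    then have "{0<..<1} \<subseteq> set_of_interval I"
      using assms same_cell_interval[of d _ I] by (auto simp: same_cell_def)
    then show ?thesis ..
  next
    case 2
    then have "{1<..<2} \<subseteq> set_of_interval I"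
      using assms same_cell_interval[of d _ I] by (auto simp: same_cell_def)
    then show ?thesis ..
  qed
qed

section \<open>Two-block timings and the game\<close>

text \<open>With \<open>n = 2m - 1\<close>, the event \<open>x\<^sub>i\<close> has index \<open>i\<close> and the event \<open>y\<^sub>j\<close> has index \<open>2m - 1 + j\<close>.\<close>

definition two_block :: "nat \<Rightarrow> (nat \<Rightarrow> real) \<Rightarrow> bool" where
  "two_block m t \<longleftrightarrow> t 0 = 0 \<and> t (4*m-1) = 2 \<and>
     (\<forall>p q. p < q \<longrightarrow> q < 4*m \<longrightarrow> t p < t q) \<and>
     (\<forall>p. p < 2*m \<longrightarrow> t p < 1) \<and>
     (\<forall>p. 2*m \<le> p \<longrightarrow> p < 4*m \<longrightarrow> 1 < t p) \<and>
     (\<forall>i j. 1 \<le> i \<longrightarrow> i < 2*m \<longrightarrow> 1 \<le> j \<longrightarrow> j < 2*m \<longrightarrow>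
        (j < i \<longrightarrow> t (2*m-1+j) - t i < 1) \<and>
        (j > i \<or> j = i \<and> i \<noteq> m \<longrightarrow> 1 < t (2*m-1+j) - t i))"

text \<open>Indices at distance at least \<open>c\<close> from the ends of a common block are identified.\<close>

definition block_equiv :: "nat \<Rightarrow> nat \<Rightarrow> nat \<Rightarrow> nat \<Rightarrow> bool" where
  "block_equiv m c p q \<longleftrightarrow> p = q \<or> c \<le> p \<and> p+c \<le> 2*m \<and> c \<le> q \<and> q+c \<le> 2*m \<or>
     2*m+c \<le> p+1 \<and> p+c < 4*m \<and> 2*m+c \<le> q+1 \<and> q+c < 4*m"

lemma block_equiv_sym: "block_equiv m c p q \<Longrightarrow> block_equiv m c q p"
  unfolding block_equiv_def by blast

text \<open>Blocks and end positions alone fix the unit cell of each of these distances, except from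
  some \<open>x\<close> to some \<open>y\<close>, where only the bound 2 is available and the finer
  comparison with 1 is left to \<open>two_block_cross\<close>.\<close>

lemma two_block_cell:
  assumes "two_block m t" "1 \<le> m"
  shows "p < q \<Longrightarrow> q < 2*m \<Longrightarrow> 0 < t q - t p \<and> t q - t p < 1"
    and "2*m \<le> p \<Longrightarrow> p < q \<Longrightarrow> q < 4*m \<Longrightarrow> 0 < t q - t p \<and> t q - t p < 1"
    and "1 \<le> p \<Longrightarrow> p < 2*m \<Longrightarrow> 2*m \<le> q \<Longrightarrow> q < 4*m \<Longrightarrow> 0 < t q - t p \<and> t q - t p < 2"
    and "1 \<le> p \<Longrightarrow> p < 2*m \<Longrightarrow> 1 < t (4*m-1) - t p \<and> t (4*m-1) - t p < 2"
    and "2*m \<le> q \<Longrightarrow> q < 4*m-1 \<Longrightarrow> 1 < t q - t 0 \<and> t q - t 0 < 2"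
proof -
  have mono: "\<And>p q. p < q \<Longrightarrow> q < 4*m \<Longrightarrow> t p < t q"
    and ends: "t 0 = 0" "t (4*m-1) = 2"
    and x: "\<And>p. p < 2*m \<Longrightarrow> t p < 1" and y: "\<And>p. 2*m \<le> p \<Longrightarrow> p < 4*m \<Longrightarrow> 1 < t p"
    using assms(1) unfolding two_block_def by blast+
  have nonneg: "0 \<le> t p" if "p < 4*m" for p
    using mono[of 0 p] that ends by (cases "p = 0") auto
  have pos: "0 < t p" if "1 \<le> p" "p < 4*m" for p
    using mono[of 0 p] that ends by auto
  have le2: "t p \<le> 2" if "p < 4*m" for p
    using mono[of p "4*m-1"] that ends 
      linorder_cases[of p "4*m-1" "t p \<le> 2"] by fastforce
  have lt2: "t p < 2" if "p < 4*m-1" for p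
    using mono[of p "4*m-1"] that ends by auto
  show "0 < t q - t p \<and> t q - t p < 1" if "p < q" "q < 2*m"
    using mono[of p q] x[of q] nonneg[of p] that by auto
  show "0 < t q - t p \<and> t q - t p < 1" if "2*m \<le> p" "p < q" "q < 4*m"
    using mono[of p q] y[of p] le2[of q] that by auto
  show "0 < t q - t p \<and> t q - t p < 2" if "1 \<le> p" "p < 2*m" "2*m \<le> q" "q < 4*m"
    using mono[of p q] pos[of p] le2[of q] that by auto
  show "1 < t (4*m-1) - t p \<and> t (4*m-1) - t p < 2" if "1 \<le> p" "p < 2*m"
    using x[of p] pos[of p] ends that by auto
  show "1 < t q - t 0 \<and> t q - t 0 < 2" if "2*m \<le> q" "q < 4*m-1"
    using y[of q] lt2[of q] ends that by auto
qed

text \<open>Restates the defining condition in absolute indices: the partner of \<open>x\<close>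
  number \<open>p\<close> on the diagonal is \<open>2*m-1+p\<close>. Only the pair \<open>m\<close>,
  \<open>3*m-1\<close> stays undetermined.\<close>

lemma two_block_cross:
  assumes "two_block m t" "1 \<le> p" "p < 2*m" "2*m \<le> q" "q < 4*m-1"
  shows "q < 2*m-1+p \<Longrightarrow> t q - t p < 1"
    and "q > 2*m-1+p \<or> q = 2*m-1+p \<and> p \<noteq> m \<Longrightarrow> 1 < t q - t p"
proof -
  define j where "j = q - (2*m-1)"
  have j: "q = 2*m-1+j" "1 \<le> j" "j < 2*m" using assms unfolding j_def by auto
  show "q < 2*m-1+p \<Longrightarrow> t q - t p < 1"
    using assms j unfolding two_block_def by auto
  show "q > 2*m-1+p \<or> q = 2*m-1+p \<and> p \<noteq> m \<Longrightarrow> 1 < t q - t p"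
    using assms j unfolding two_block_def by auto
qed

text \<open>A legal reply to an Until move from \<open>p\<close> to \<open>q\<close>. Every position
  in the new gap needs a counterpart in the old gap, because the first argument of Until must be
  carried over to the whole new gap.\<close>

definition move :: "nat \<Rightarrow> nat \<Rightarrow> interval \<Rightarrow> (nat \<Rightarrow> real) \<Rightarrow> nat \<Rightarrow> nat \<Rightarrow> nat \<Rightarrow> nat \<Rightarrow> bool" where
  "move m c I t' p q p' q' \<longleftrightarrow> p' < q' \<and> q' < 4*m \<and> t' q' - t' p' \<in> set_of_interval I \<and>
     block_equiv m c q q' \<and> (\<forall>r'. p' < r' \<and> r' < q' \<longrightarrow> (\<exists>r. p < r \<and> r < q \<and> block_equiv m c r r'))"

lemma move_sameI:
  assumes "p' < q" "q < 4*m" "same_cell (t q - t p) (t' q - t' p')" "t q - t p \<in> set_of_interval I"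
    and "\<And>r'. p' < r' \<Longrightarrow> r' < q \<Longrightarrow> \<exists>r. p < r \<and> r < q \<and> block_equiv m c r r'"
  shows "move m c I t' p q p' q"
  using assms same_cell_interval unfolding move_def block_equiv_def by blast

text \<open>Serves the reply with \<open>q\<close> itself. A position beyond \<open>p\<close>
  matches itself; one after \<open>p'\<close> and up to \<open>p\<close> is matched by
  \<open>p+1\<close>, which has margin \<open>c\<close> because \<open>p\<close> has margin
  \<open>c+1\<close>. For \<open>p \<noteq> p'\<close> the disjunctive hypothesis puts
  \<open>q\<close> near the end of the block or past it, so that \<open>p+1\<close> still precedes
  \<open>q\<close>.\<close>

lemma between_within_block:
  assumes "block_equiv m (c+1) p p'" "1 \<le> c" "c+1 \<le> m" "p < q"
    and "p = p' \<or> (p < 2*m \<longrightarrow> 2*m < q+c) \<and> (2*m \<le> p \<longrightarrow> 4*m \<le> q+c)"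
    and "p' < r'" "r' < q"
  shows "\<exists>r. p < r \<and> r < q \<and> block_equiv m c r r'"
proof (cases "p < r'")
  case True
  then show ?thesis using assms unfolding block_equiv_def by blast
next
  case False
  then have "p \<noteq> p'" using assms(6) by blast
  then have "p+1 < q" "block_equiv m c (p+1) r'"
    using False assms unfolding block_equiv_def by linarith+
  then show ?thesis by (intro exI[of _ "p+1"]) simp
qed

lemma until_move:
  assumes t: "two_block m t" and t': "two_block m t'" and c: "1 \<le> c" "c+1 \<le> m"
    and eq: "block_equiv m (c+1) p p'" and pq: "p < q" "q < 4*m"
    and I: "t q - t p \<in> set_of_interval I" "\<not> singular I"
  shows "\<exists>q'. move m c I t' p q p' q'"
proof -
  have m: "1 \<le> m" using c by simp
  note C = two_block_cell[OF t m] and C' = two_block_cell[OF t' m]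
  note X = two_block_cross[OF t] and X' = two_block_cross[OF t']
  have ends: "t 0 = 0" "t' 0 = 0" "t (4*m-1) = 2" "t' (4*m-1) = 2"
    using t t' unfolding two_block_def by auto
  show ?thesis
  \<comment> \<open>If \<open>q\<close> is in the same block as \<open>p\<close> and not near its
    end, the successor of \<open>p'\<close> is a reply with an empty gap. Otherwise \<open>q\<close>
    itself is tried first, and it fails only if the two distances fall into different cells.\<close>
  proof (cases "p \<noteq> p' \<and> (p < 2*m \<and> q+c \<le> 2*m \<or> 2*m \<le> p \<and> q+c < 4*m)")
    case True
    then have "p'+1 < 4*m" "block_equiv m c q (p'+1)"
      and "p < 2*m \<and> q < 2*m \<and> p'+1 < 2*m \<or> 2*m \<le> p \<and> 2*m \<le> p'"
      using eq c pq unfolding block_equiv_def by linarith+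
    moreover from this(3) have "same_cell (t q - t p) (t' (p'+1) - t' p')"
      using pq C(1,2)[of p q] C'(1,2)[of p' "p'+1"] calculation(1)
      unfolding same_cell_def by auto
    ultimately have "move m c I t' p q p' (p'+1)"
      using same_cell_interval I(1) unfolding move_def by auto
    then show ?thesis ..
  next
    case False
    note between = between_within_block[OF eq c pq(1)]
    have p'q: "p' < q" using False eq pq c unfolding block_equiv_def by linarith
    have btw: "\<And>r'. p' < r' \<Longrightarrow> r' < q \<Longrightarrow> \<exists>r. p < r \<and> r < q \<and> block_equiv m c r r'"
      by (rule between) (use False in linarith)
    show ?thesis
    proof (cases "same_cell (t q - t p) (t' q - t' p')")
      case True
      then show ?thesis using move_sameI[OF p'q pq(2) True I(1) btw] by blast
    next
      case diff: False
      have q: "2*m \<le> q" "p < 2*m"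
      proof -
        have "\<not> (q < 2*m)" using diff C(1)[of p q] C'(1)[of p' q] pq p'q
          unfolding same_cell_def by auto
        then show "2*m \<le> q" by simp
        show "p < 2*m"
        proof (rule ccontr)
          assume "\<not> p < 2*m"
          moreover from this have "2*m \<le> p'" using eq c unfolding block_equiv_def by linarith
          ultimately show False using diff C(2)[of p q] C'(2)[of p' q] pq p'q
            unfolding same_cell_def by auto
        qed
      qed
      have p: "1 \<le> p"
      proof (rule ccontr)
        assume "\<not> 1 \<le> p"
        then have p0: "p = 0" "p' = 0" using eq c unfolding block_equiv_def by linarith+
        then show False using diff ends C(5)[of q] C'(5)[of q] q pq
          unfolding same_cell_def by (cases "q = 4*m-1") auto
      qed
      have p': "1 \<le> p'" "p' < 2*m" using p q eq c unfolding block_equiv_def by linarith+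
      have q': "q < 4*m-1"
        using diff C(4)[of p] C'(4)[of p'] p p' q pq
        unfolding same_cell_def by (cases "q = 4*m-1") auto
      have range: "0 < t q - t p" "t q - t p < 2" "0 < t' q - t' p'" "t' q - t' p' < 2"
        using C(3)[of p q] C'(3)[of p' q] p p' q q' by auto
      have notlow: "\<not> (q < 2*m-1+p \<and> q < 2*m-1+p')"
        using diff X(1)[of p q] X'(1)[of p' q] range p p' q q' unfolding same_cell_def by auto
      have nothigh: "\<not> ((q > 2*m-1+p \<or> q = 2*m-1+p \<and> p \<noteq> m) \<and> (q > 2*m-1+p' \<or> q = 2*m-1+p' \<and> p' \<noteq> m))"
        using diff X(2)[of p q] X'(2)[of p' q] range p p' q q' unfolding same_cell_def by auto
      \<comment> \<open>By the last two facts \<open>q\<close> lies weakly between the diagonal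
        partners of \<open>p\<close> and \<open>p'\<close>, and \<open>p = p'\<close> forces
        \<open>p = m\<close> and \<open>q = 3*m-1\<close>. Hence \<open>q\<close> inherits the
        margin of \<open>p\<close> and \<open>p'\<close>, or has it because
        \<open>c+1 \<le> m\<close>.\<close>
      have mid: "c+1 \<le> p" "p+(c+1) \<le> 2*m" "c+1 \<le> p'" "p'+(c+1) \<le> 2*m"
          "2*m+(c+1) \<le> q+1" "q+(c+1) < 4*m"
        using notlow nothigh eq c p p' q unfolding block_equiv_def by linarith+
      have ans: "move m c I t' p q p' q'"
        if q': "2*m+c \<le> q'+1" "q'+c < 4*m" and I': "t' q' - t' p' \<in> set_of_interval I" for q'
      proof -
        have "\<exists>r. p < r \<and> r < q \<and> block_equiv m c r r'" if r': "p' < r'" "r' < q'" for r'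
        proof (cases "r' < q")
          case True
          then show ?thesis using btw r' by blast
        next
          case False
          \<comment> \<open>Positions from \<open>q\<close> onwards are matched by
            \<open>q-1\<close>, at the cost of one unit of margin.\<close>
          then have "p < q-1" "q-1 < q" "block_equiv m c (q-1) r'"
            using mid r' q' c unfolding block_equiv_def by linarith+
          then show ?thesis by blast
        qed
        moreover have "p' < q'" "q' < 4*m" "block_equiv m c q q'"
          using q' mid c unfolding block_equiv_def by linarith+
        ultimately show ?thesis using I' unfolding move_def by blast
      qed
      \<comment> \<open>The two neighbours of the diagonal partner \<open>2*m-1+p'\<close> of
        \<open>p'\<close>: their distances from \<open>p'\<close> lie in \<open>(0,1)\<close> and
        \<open>(1,2)\<close>, and \<open>I\<close> contains one of these cells.\<close>
      define low high where "low = 2*m+p'-2" and "high = 2*m+p'"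
      have low: "2*m+c \<le> low+1" "low+c < 4*m" and high: "2*m+c \<le> high+1" "high+c < 4*m"
        and "2*m \<le> low" "low < 4*m-1" "low < 2*m-1+p'"
        and "2*m \<le> high" "high < 4*m-1" "high > 2*m-1+p'"
        using mid c unfolding low_def high_def by linarith+
      then have "t' low - t' p' \<in> {0<..<1}" "t' high - t' p' \<in> {1<..<2}"
        using X'(1)[of p' low] X'(2)[of p' high] C'(3)[of p' low] C'(3)[of p' high] p' by auto
      then show ?thesis
        using nonsingular_interval_contains_cell[OF I range(1,2)] ans[OF low] ans[OF high] by blast
    qed
  qed
qed

text \<open>The class of two-block timings is closed under time reversal, which turns \<open>S\<close> into \<open>U\<close>.\<close>

definition mirror :: "nat \<Rightarrow> (nat \<Rightarrow> real) \<Rightarrow> nat \<Rightarrow> real" where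
  "mirror m t p = 2 - t (4*m-1-p)"

text \<open>Reversal sends \<open>x\<close> number \<open>i\<close> to \<open>y\<close> number
  \<open>2*m-i\<close> and vice versa, so the order of the two indices is preserved in the
  comparison with 1, and the exceptional index \<open>m\<close> is fixed.\<close>

lemma two_block_mirror:
  assumes "two_block m t" "1 \<le> m"
  shows "two_block m (mirror m t)"
proof -
  have "(j < i \<longrightarrow> mirror m t (2*m-1+j) - mirror m t i < 1) \<and>
        (j > i \<or> j = i \<and> i \<noteq> m \<longrightarrow> 1 < mirror m t (2*m-1+j) - mirror m t i)"
    if ij: "1 \<le> i" "i < 2*m" "1 \<le> j" "j < 2*m" for i j
  proof -
    have "4*m-1-(2*m-1+j) = 2*m-j" "4*m-1-i = 2*m-1+(2*m-i)" using ij by auto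
    moreover have "2*m-1+(2*m-i) < 2*m-1+(2*m-j) \<longleftrightarrow> j < i"
      "2*m-1+(2*m-i) > 2*m-1+(2*m-j) \<longleftrightarrow> i < j"
      "2*m-1+(2*m-i) = 2*m-1+(2*m-j) \<longleftrightarrow> j = i" "2*m-j \<noteq> m \<longleftrightarrow> j \<noteq> m"
      "1 \<le> 2*m-j" "2*m-j < 2*m" "2*m \<le> 2*m-1+(2*m-i)" "2*m-1+(2*m-i) < 4*m-1"
      using ij by linarith+
    ultimately show ?thesis
      using two_block_cross[OF assms(1), of "2*m-j" "2*m-1+(2*m-i)"]
      unfolding mirror_def by force
  qed
  then show ?thesis
    using assms unfolding two_block_def mirror_def by auto
qed

lemma block_equiv_mirror:
  assumes "block_equiv m c p q"
  shows "block_equiv m c (4*m-1-p) (4*m-1-q)"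
proof (cases "p = q")
  case True
  then show ?thesis unfolding block_equiv_def by simp
next
  case False
  define p' q' where "p' = 4*m-1-p" and "q' = 4*m-1-q"
  have "c \<le> p \<and> p+c \<le> 2*m \<and> c \<le> q \<and> q+c \<le> 2*m \<or>
     2*m+c \<le> p+1 \<and> p+c < 4*m \<and> 2*m+c \<le> q+1 \<and> q+c < 4*m"
    using assms False unfolding block_equiv_def by blast
  moreover from this have "p < 4*m" "q < 4*m" using False by linarith+
  then have "p' + p + 1 = 4*m" "q' + q + 1 = 4*m" unfolding p'_def q'_def by simp_all
  ultimately have "block_equiv m c p' q'" unfolding block_equiv_def by linarith
  then show ?thesis unfolding p'_def q'_def .
qed

lemma since_move:
  assumes t: "two_block m t" and t': "two_block m t'" and c: "1 \<le> c" "c+1 \<le> m"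
    and eq: "block_equiv m (c+1) p p'" and pq: "q < p" "p < 4*m" "p' < 4*m"
    and I: "t p - t q \<in> set_of_interval I" "\<not> singular I"
  shows "\<exists>q'. q' < p' \<and> t' p' - t' q' \<in> set_of_interval I \<and> block_equiv m c q q' \<and>
           (\<forall>r'. q' < r' \<and> r' < p' \<longrightarrow> (\<exists>r. q < r \<and> r < p \<and> block_equiv m c r r'))"
proof -
  let ?f = "\<lambda>p. 4*m-1-p"
  have m: "1 \<le> m" using c by simp
  \<comment> \<open>Truncated subtraction makes the reversal an involution only below
    \<open>4*m\<close>.\<close>
  have ff: "?f (?f s) = s" if "s < 4*m" for s using that by auto
  have "\<exists>q'. move m c I (mirror m t') (?f p) (?f q) (?f p') q'"
  proof (rule until_move[OF two_block_mirror[OF t m] two_block_mirror[OF t' m] c])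
    show "block_equiv m (c+1) (?f p) (?f p')" using block_equiv_mirror[OF eq] c by simp
    show "mirror m t (?f q) - mirror m t (?f p) \<in> set_of_interval I"
      using ff[of p] ff[of q] pq I by (simp add: mirror_def)
  qed (use pq I in auto)
  then obtain q' where q': "?f p' < q'" "q' < 4*m"
      "mirror m t' q' - mirror m t' (?f p') \<in> set_of_interval I" "block_equiv m c (?f q) q'"
      "\<And>r'. ?f p' < r' \<Longrightarrow> r' < q' \<Longrightarrow> \<exists>r. ?f p < r \<and> r < ?f q \<and> block_equiv m c r r'"
    unfolding move_def by blast
  have "?f q' < p'" using q' pq by auto
  moreover have "t' p' - t' (?f q') \<in> set_of_interval I"
    using q'(3) ff[OF pq(3)] by (simp add: mirror_def)
  moreover have "block_equiv m c q (?f q')"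
    using block_equiv_mirror[OF q'(4)] c ff[of q] pq by simp
  moreover have "\<exists>r. q < r \<and> r < p \<and> block_equiv m c r r'" if r': "?f q' < r'" "r' < p'" for r'
  proof -
    have "?f p' < ?f r'" "?f r' < q'" using r' pq q' by auto
    then obtain r where r: "?f p < r" "r < ?f q" "block_equiv m c r (?f r')" using q'(5) by blast
    have "block_equiv m c (?f r) r'" using block_equiv_mirror[OF r(3)] c ff[of r'] r' pq by simp
    moreover have "q < ?f r" "?f r < p" using r pq by auto
    ultimately show ?thesis by blast
  qed
  ultimately show ?thesis by blast
qed

section \<open>Invariance of MITL\<close>

definition word :: "'a \<Rightarrow> nat \<Rightarrow> (nat \<Rightarrow> real) \<Rightarrow> ('a \<times> real) list" where
  "word a m t = map (\<lambda>p. (a, t p)) [0..<4*m]"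

lemma word_simps [simp]:
  "length (word a m t) = 4*m"
  "p < 4*m \<Longrightarrow> word a m t ! p = (a, t p)"
  unfolding word_def by auto

primrec depth :: "'a mtl \<Rightarrow> nat" where
  "depth (Letter a) = 0"
| "depth (Conj \<phi> \<psi>) = max (depth \<phi>) (depth \<psi>)"
| "depth (Neg \<phi>) = depth \<phi>"
| "depth (Until \<phi> I \<psi>) = Suc (max (depth \<phi>) (depth \<psi>))"
| "depth (Since \<phi> I \<psi>) = Suc (max (depth \<phi>) (depth \<psi>))"

lemma until_transfer:
  assumes "two_block m t" "two_block m t'" "1 \<le> c" "c+1 \<le> m" "block_equiv m (c+1) p p'"
    and "p < 4*m" "p' < 4*m" "\<not> singular I"
    and 1: "\<And>q q'. block_equiv m c q q' \<Longrightarrow> q < 4*m \<Longrightarrow> q' < 4*m \<Longrightarrow>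
           sat (word a m t) q \<phi> = sat (word a m t') q' \<phi>"
    and 2: "\<And>q q'. block_equiv m c q q' \<Longrightarrow> q < 4*m \<Longrightarrow> q' < 4*m \<Longrightarrow>
           sat (word a m t) q \<psi> = sat (word a m t') q' \<psi>"
    and "sat (word a m t) p (Until \<phi> I \<psi>)"
  shows "sat (word a m t') p' (Until \<phi> I \<psi>)"
proof -
  obtain q where q: "p < q" "q < 4*m" "sat (word a m t) q \<psi>" "t q - t p \<in> set_of_interval I"
    "\<And>r. p < r \<Longrightarrow> r < q \<Longrightarrow> sat (word a m t) r \<phi>"
    using assms by auto
  obtain q' where q': "p' < q'" "q' < 4*m" "t' q' - t' p' \<in> set_of_interval I" "block_equiv m c q q'"
     "\<And>r'. p' < r' \<Longrightarrow> r' < q' \<Longrightarrow> \<exists>r. p < r \<and> r < q \<and> block_equiv m c r r'"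
    using until_move[OF assms(1-5) q(1,2,4) assms(8)] unfolding move_def by blast
  have "sat (word a m t') r' \<phi>" if r': "p' < r'" "r' < q'" for r'
  proof -
    obtain r where "p < r" "r < q" "block_equiv m c r r'" using q'(5) r' by blast
    then show ?thesis using 1[of r r'] q r' q'(2) by simp
  qed
  moreover have "sat (word a m t') q' \<psi>" using 2 q q' by blast
  ultimately show ?thesis using q' assms(7) by auto
qed

lemma since_transfer:
  assumes "two_block m t" "two_block m t'" "1 \<le> c" "c+1 \<le> m" "block_equiv m (c+1) p p'"
    and "p < 4*m" "p' < 4*m" "\<not> singular I"
    and 1: "\<And>q q'. block_equiv m c q q' \<Longrightarrow> q < 4*m \<Longrightarrow> q' < 4*m \<Longrightarrow>
           sat (word a m t) q \<phi> = sat (word a m t') q' \<phi>"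
    and 2: "\<And>q q'. block_equiv m c q q' \<Longrightarrow> q < 4*m \<Longrightarrow> q' < 4*m \<Longrightarrow>
           sat (word a m t) q \<psi> = sat (word a m t') q' \<psi>"
    and "sat (word a m t) p (Since \<phi> I \<psi>)"
  shows "sat (word a m t') p' (Since \<phi> I \<psi>)"
proof -
  obtain q where q: "q < p" "sat (word a m t) q \<psi>" "t p - t q \<in> set_of_interval I"
    "\<And>r. q < r \<Longrightarrow> r < p \<Longrightarrow> sat (word a m t) r \<phi>"
    using assms by auto
  obtain q' where q': "q' < p'" "t' p' - t' q' \<in> set_of_interval I" "block_equiv m c q q'"
     "\<And>r'. q' < r' \<Longrightarrow> r' < p' \<Longrightarrow> \<exists>r. q < r \<and> r < p \<and> block_equiv m c r r'"
    using since_move[OF assms(1-5) q(1) assms(6,7) q(3) assms(8)] by blast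
  have "sat (word a m t') r' \<phi>" if r': "q' < r'" "r' < p'" for r'
  proof -
    obtain r where "q < r" "r < p" "block_equiv m c r r'" using q'(4) r' by blast
    then show ?thesis using 1[of r r'] q r' assms(6,7) by simp
  qed
  moreover have "sat (word a m t') q' \<psi>" using 2[of q q'] q q' assms(6,7) by simp
  ultimately show ?thesis using q' assms(7) by auto
qed

text \<open>Each nested modality costs one unit of the margin \<open>c\<close>. Since
  \<open>c\<close> exceeds the depth, the margin left after every move is at least 1, as the move
  lemmas require.\<close>

lemma MITL_invariant:
  assumes "two_block m t" "two_block m t'" "\<forall>I \<in> intervals \<psi>. \<not> singular I"
    and "depth \<psi> < c" "c \<le> m" "block_equiv m c p p'" "p < 4*m" "p' < 4*m"
  shows "sat (word a m t) p \<psi> = sat (word a m t') p' \<psi>"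
  using assms
proof (induction \<psi> arbitrary: t t' c p p')
  case (Conj \<psi>1 \<psi>2)
  show ?case using Conj.IH[of t t' c p p'] Conj.prems by simp
next
  case (Neg \<psi>)
  show ?case using Neg.IH[of t t' c p p'] Neg.prems by simp
next
  case (Until \<psi>1 I \<psi>2)
  obtain d where d: "c = d + 1" "1 \<le> d" "depth \<psi>1 < d" "depth \<psi>2 < d" "d + 1 \<le> m"
    using Until.prems by (cases c) auto
  \<comment> \<open>One implication for arbitrary timings \<open>s\<close> and \<open>s'\<close>:
    exchanging the two words yields the converse.\<close>
  have "sat (word a m s') q' (Until \<psi>1 I \<psi>2)"
    if "two_block m s" "two_block m s'" "block_equiv m (d+1) q q'" "q < 4*m" "q' < 4*m"
      "sat (word a m s) q (Until \<psi>1 I \<psi>2)" for s s' q q'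
    using that Until.prems d
    by (intro until_transfer[of m s s' d q q' I a \<psi>1 \<psi>2] Until.IH(1)[of s s' d] Until.IH(2)[of s s' d]) auto
  then show ?case
    using Until.prems d(1) block_equiv_sym by metis
next
  case (Since \<psi>1 I \<psi>2)
  obtain d where d: "c = d + 1" "1 \<le> d" "depth \<psi>1 < d" "depth \<psi>2 < d" "d + 1 \<le> m"
    using Since.prems by (cases c) auto
  have "sat (word a m s') q' (Since \<psi>1 I \<psi>2)"
    if "two_block m s" "two_block m s'" "block_equiv m (d+1) q q'" "q < 4*m" "q' < 4*m"
      "sat (word a m s) q (Since \<psi>1 I \<psi>2)" for s s' q q'
    using that Since.prems d
    by (intro since_transfer[of m s s' d q q' I a \<psi>1 \<psi>2] Since.IH(1)[of s s' d] Since.IH(2)[of s s' d]) auto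
  then show ?case
    using Since.prems d(1) block_equiv_sym by metis
qed simp

section \<open>The separating formula and words\<close>

lemma timed_word_two_block:
  assumes "two_block m t" "1 \<le> m"
  shows "timed_word (word a m t)"
proof -
  have mono: "\<And>p q. p < q \<Longrightarrow> q < 4*m \<Longrightarrow> t p < t q" and t0: "t 0 = 0"
    using assms(1) unfolding two_block_def by blast+
  have "0 \<le> t p" if "p < 4*m" for p
    using mono[of 0 p] that t0 by (cases "p = 0") auto
  moreover have "sorted (map snd (word a m t))"
    using mono by (auto simp: sorted_iff_nth_mono_less intro: less_imp_le)
  moreover have "hd (word a m t) = (a, 0)" "word a m t \<noteq> []"
    using assms(2) t0 by (auto simp: hd_conv_nth word_def)
  ultimately show ?thesis unfolding timed_word_def word_def by auto
qed

lemma sat_Top: "sat \<rho> i Top"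
  unfolding Top_def Let_def by simp

lemma Top_MTL_FP: "Top \<in> MTL_FP"
  unfolding Top_def Let_def by (intro MTL_FP.intros)

lemma intervals_Top: "intervals Top = {}"
  unfolding Top_def Let_def by simp

definition open_unit :: interval where "open_unit = Interval {0<..<1}"
definition point_one :: interval where "point_one = Interval {1..1}"

lemma set_open_unit: "set_of_interval open_unit = {0<..<1}"
  unfolding open_unit_def
  by (rule Interval_inverse) (intro CollectI exI[of _ 0] exI[of _ 1], simp)

lemma set_point_one: "set_of_interval point_one = {1..1}"
  unfolding point_one_def
  by (rule Interval_inverse) (intro CollectI exI[of _ 1], simp)

definition separator :: "'a mtl" where
  "separator = Fut open_unit (Fut point_one Top)"

lemma separator_BMTL_FP: "separator \<in> BMTL_FP"
proof -
  have "separator \<in> MTL_FP"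
    unfolding separator_def by (intro MTL_FP.intros Top_MTL_FP)
  then show ?thesis
    by (simp add: BMTL_FP_def BMTL_US_def separator_def Fut_def intervals_Top
        bounded_interval_def set_open_unit set_point_one)
qed

text \<open>All other pairs starting strictly between times 0 and 1 have a distance different from
  1, by the two preceding analyses of distances.\<close>

lemma sat_separator_iff:
  assumes t: "two_block m t" and m: "1 \<le> m"
  shows "sat (word a m t) 0 separator \<longleftrightarrow> t (3*m-1) - t m = 1"
proof
  note C = two_block_cell[OF t m] and X = two_block_cross[OF t]
  assume "sat (word a m t) 0 separator"
  then obtain p q where pq: "0 < p" "p < q" "q < 4*m" "0 < t p - t 0" "t p - t 0 < 1" "t q - t p = 1"
    by (auto simp: separator_def Fut_def sat_Top set_open_unit set_point_one)
  have "t 0 = 0" using t unfolding two_block_def by blast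
  then have p: "p < 2*m" using pq t unfolding two_block_def
    by (metis diff_zero less_le_not_le less_trans linorder_not_less order_less_imp_not_less)
  moreover have q: "2*m \<le> q" using C(1)[of p q] pq by (cases "q < 2*m") auto
  moreover have q': "q < 4*m-1" using C(4)[of p] pq p by (cases "q = 4*m-1") auto
  ultimately have "\<not> q < 2*m-1+p" "\<not> (q > 2*m-1+p \<or> q = 2*m-1+p \<and> p \<noteq> m)"
    using X(1)[of p q] X(2)[of p q] pq by auto
  then have "p = m" "q = 3*m-1" using m by linarith+
  then show "t (3*m-1) - t m = 1" using pq by simp
next
  note C = two_block_cell[OF t m]
  assume *: "t (3*m-1) - t m = 1"
  have "m < 3*m-1" "3*m-1 < 4*m" "0 < m" "m < 4*m" using m by linarith+
  moreover have "0 < t m - t 0" "t m - t 0 < 1" using C(1)[of 0 m] m by auto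
  moreover from this(1) have "sat (word a m t) m (Fut point_one Top)"
    using * calculation(1,2,4)
    by (auto simp: Fut_def sat_Top set_point_one intro!: exI[of _ "3*m-1"])
  ultimately show "sat (word a m t) 0 separator"
    unfolding separator_def Fut_def[of open_unit]
    by (auto simp: sat_Top set_open_unit intro!: exI[of _ m])
qed

text \<open>In units of \<open>1/(4*m)\<close>, \<open>x\<close> number \<open>i\<close> is at
  \<open>2*i\<close> and \<open>y\<close> number \<open>j\<close> at \<open>4*m+2*j+1\<close>, so
  their distance exceeds \<open>4*m\<close> by the odd number \<open>2*(j-i)+1\<close>, positive iff
  \<open>j \<ge> i\<close>. For \<open>j = m\<close> the final 1 becomes \<open>e\<close>, which
  gives the middle pair the distance \<open>4*m+e\<close>.\<close>

definition timing :: "nat \<Rightarrow> real \<Rightarrow> nat \<Rightarrow> real" where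
  "timing m e p = (if p < 2*m then 2 * real p else if p = 4*m-1 then 8 * real m
     else 2 * real p + 2 + (if p = 3*m-1 then e else 1)) / (4 * real m)"

lemma two_block_timing:
  assumes "1 \<le> m" "0 \<le> e" "e \<le> 1"
  shows "two_block m (timing m e)"
proof -
  define g where "g p = (if p < 2*m then 2 * real p else if p = 4*m-1 then 8 * real m
     else 2 * real p + 2 + (if p = 3*m-1 then e else 1))" for p
  have timing: "timing m e p = g p / (4 * real m)" for p
    unfolding timing_def g_def ..
  have m: "0 < 4 * real m" using assms by simp
  have "g p < g q" if "p < q" "q < 4*m" for p q
    using that assms unfolding g_def by auto
  moreover have "g p < 4 * real m" if "p < 2*m" for p
    using that assms unfolding g_def by auto
  moreover have "4 * real m < g p" if "2*m \<le> p" "p < 4*m" for p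
    using that assms unfolding g_def by auto
  moreover have "(j < i \<longrightarrow> g (2*m-1+j) - g i < 4 * real m) \<and>
        (j > i \<or> j = i \<and> i \<noteq> m \<longrightarrow> 4 * real m < g (2*m-1+j) - g i)"
    if "1 \<le> i" "i < 2*m" "1 \<le> j" "j < 2*m" for i j
    using that assms unfolding g_def by (auto simp: of_nat_diff)
  moreover have "g 0 = 0" "g (4*m-1) = 8 * real m" using assms unfolding g_def by auto
  ultimately show ?thesis
    using m unfolding two_block_def timing diff_divide_distrib[symmetric]
    by (simp add: divide_less_eq less_divide_eq)
qed

theorem theorem3:
  "\<exists>\<phi> :: 'a::finite mtl. \<phi> \<in> BMTL_FP \<and> \<not> (\<exists>\<psi> \<in> MITL_US. lang \<psi> = lang \<phi>)"
proof (intro exI conjI notI)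
  show "separator \<in> (BMTL_FP :: 'a mtl set)" by (rule separator_BMTL_FP)
next
  assume "\<exists>\<psi> \<in> MITL_US. lang \<psi> = lang (separator :: 'a mtl)"
  then obtain \<psi> :: "'a mtl" where \<psi>: "\<psi> \<in> MITL_US" "lang \<psi> = lang separator" by blast
  define m where "m = Suc (depth \<psi>)"
  define a :: 'a where "a = undefined"
  have m: "1 \<le> m" unfolding m_def by simp
  have w: "two_block m (timing m 0)" "two_block m (timing m 1)"
    using two_block_timing m by auto
  have lang: "sat (word a m t) 0 \<psi> \<longleftrightarrow> t (3*m-1) - t m = 1" if "two_block m t" for t
  proof -
    have "word a m t \<in> lang \<psi> \<longleftrightarrow> word a m t \<in> lang separator" using \<psi>(2) by simp
    then show ?thesis
      using timed_word_two_block[OF that m, of a] sat_separator_iff[OF that m, of a] by (simp add: lang_def)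
  qed
  \<comment> \<open>Position 0 is equivalent to itself at any margin, so the full margin
    \<open>m\<close>, one more than the depth of \<open>\<psi>\<close>, is available at the
    start.\<close>
  have "sat (word a m (timing m 0)) 0 \<psi> = sat (word a m (timing m 1)) 0 \<psi>"
    by (rule MITL_invariant[OF w, where c = m])
      (use \<psi>(1) in \<open>auto simp: MITL_US_def m_def block_equiv_def\<close>)
  moreover have "timing m e (3*m-1) - timing m e m = 1 + e / (4 * real m)" for e
  proof -
    have "\<not> 3*m-1 < 2*m" "3*m-1 \<noteq> 4*m-1" "m < 2*m" "real (3*m-1) = 3 * real m - 1"
      using m by (auto simp: of_nat_diff)
    then show ?thesis using m by (simp add: timing_def field_simps)
  qed
  ultimately show False using lang[OF w(1)] lang[OF w(2)] m by simp
qed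

end
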